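(* Let $0<q<1$. The series $$F(w,z):=\sum_{k=0}^\infty \frac{(-1)^k\,q^{k(k-1)/2}\,(q^k w;q)_\infty\,z^k}{(q;q)_k}$$ (which equals $(w;q)_\infty\,{}_1\phi_1(0;w;q,z)$ when $w\notin\{1,q^{-1},q^{-2},\dots\}$) defines an entire analytic function of $(z,w)\in\mathbb{C}^2$. It is symmetric in $z$ and $w$: $F(w,z)=F(z,w)$ for all $z,w\in\mathbb{C}$, i.e. $$(w;q)_\infty\,{}_1\phi_1(0;w;q,z)=(z;q)_\infty\,{}_1\phi_1(0;z;q,w),$$ where each side is interpreted through the series $F$. Moreover, for all $z,w\in\mathbb{C}$, $$|F(w,z)|\le(-|z|;q)_\infty\,(-|w|;q)_\infty .$$
   Context: For $0<q<1$ and $a\in\mathbb{C}$: $(a;q)_0:=1$, $(a;q)_k:=\prod_{j=0}^{k-1}(1-aq^j)$ for $k\ge1$, and $(a;q)_\infty:=\lim_{k\to\infty}(a;q)_k$. For $w\notin\{1,q^{-1},q^{-2},\dots\}$, $${}_1\phi_1(0;w;q,z):=\sum_{k=0}^\infty\frac{(-1)^k q^{k(k-1)/2} z^k}{(w;q)_k\,(q;q)_k}.$$ The expression $(w;q)_\infty\,{}_1\phi_1(0;w;q,z)$ is extended to all $w\in\mathbb{C}$ by the series $F(w,z)$ of the claim. *)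

theory Defs
  imports "HOL-Analysis.Analysis"
begin

text \<open>
  The base \<open>q\<close> is real throughout; the parameter \<open>a\<close> of a \<open>q\<close>-shifted factorial may be real or
  complex, so that \<open>(-\<bar>z\<bar>; q)\<^sub>\<infinity>\<close> is available as a real number.
\<close>

definition qpoch :: "'a::real_normed_field \<Rightarrow> real \<Rightarrow> nat \<Rightarrow> 'a" where
  "qpoch a q k = (\<Prod>j<k. 1 - a * of_real q ^ j)"

definition qpoch_inf :: "'a::real_normed_field \<Rightarrow> real \<Rightarrow> 'a" where
  "qpoch_inf a q = lim (\<lambda>k. qpoch a q k)"

text \<open>
  The series \<open>\<^sub>1\<phi>\<^sub>1(0; w; q, z)\<close>. It is meaningful only for \<open>w\<close> outside \<open>{1, q\<^sup>-\<^sup>1, q\<^sup>-\<^sup>2, \<dots>}\<close>;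
  elsewhere all but finitely many of its denominators vanish, and division by zero makes those
  terms zero.
\<close>

definition phi11_term :: "real \<Rightarrow> complex \<Rightarrow> complex \<Rightarrow> nat \<Rightarrow> complex" where
  "phi11_term q w z k =
     (-1) ^ k * of_real q ^ (k * (k - 1) div 2) * z ^ k / (qpoch w q k * qpoch (of_real q) q k)"

definition phi11 :: "real \<Rightarrow> complex \<Rightarrow> complex \<Rightarrow> complex" where
  "phi11 q w z = (\<Sum>k. phi11_term q w z k)"

definition F_term :: "real \<Rightarrow> complex \<Rightarrow> complex \<Rightarrow> nat \<Rightarrow> complex" where
  "F_term q w z k =
     (-1) ^ k * of_real q ^ (k * (k - 1) div 2) * qpoch_inf (of_real q ^ k * w) q * z ^ k
       / qpoch (of_real q) q k"

definition F :: "real \<Rightarrow> complex \<Rightarrow> complex \<Rightarrow> complex" where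
  "F q w z = (\<Sum>k. F_term q w z k)"

text \<open>
  Analyticity in two complex variables: near every point the function is the sum of a double power
  series. Summation is unordered over all pairs of exponents, which for complex numbers is the same
  as absolute convergence.
\<close>

definition analytic2_at :: "(complex \<times> complex \<Rightarrow> complex) \<Rightarrow> complex \<times> complex \<Rightarrow> bool" where
  "analytic2_at f p \<longleftrightarrow>
     (\<exists>r>0. \<exists>c :: nat \<Rightarrow> nat \<Rightarrow> complex. \<forall>x y.
        dist x (fst p) < r \<and> dist y (snd p) < r \<longrightarrow>
        ((\<lambda>(m, n). c m n * (x - fst p) ^ m * (y - snd p) ^ n) has_sum f (x, y)) UNIV)"

definition entire2 :: "(complex \<times> complex \<Rightarrow> complex) \<Rightarrow> bool" where
  "entire2 f \<longleftrightarrow> (\<forall>p. analytic2_at f p)"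

text \<open>The limits and the \<open>\<^sub>1\<phi>\<^sub>1\<close> series exist, so \<open>lim\<close> and \<open>suminf\<close> return no default values.\<close>

lemma qpoch_LIMSEQ:
  fixes a :: "'a::{real_normed_field,banach}"
  assumes "0 < q" "q < 1"
  shows "(\<lambda>k. qpoch a q k) \<longlonglongrightarrow> qpoch_inf a q"
proof -
  have "summable (\<lambda>j. norm a * q ^ j)"
    using assms by (intro summable_mult summable_geometric) auto
  then have "summable (\<lambda>j. norm ((1 - a * of_real q ^ j) - 1))"
    using assms by (simp add: norm_mult norm_power)
  then have "abs_convergent_prod (\<lambda>j. 1 - a * of_real q ^ j)"
    by (simp add: abs_convergent_prod_conv_summable)
  then have "convergent_prod (\<lambda>j. 1 - a * of_real q ^ j)"
    by (rule abs_convergent_prod_imp_convergent_prod)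
  then have "convergent (\<lambda>k. \<Prod>j\<le>k. 1 - a * of_real q ^ j)"
    by (rule convergent_prod_imp_convergent)
  then have "convergent (\<lambda>k. qpoch a q (Suc k))"
    by (simp add: qpoch_def lessThan_Suc_atMost)
  then have "convergent (\<lambda>k. qpoch a q k)"
    by (subst (asm) convergent_Suc_iff)
  then show ?thesis
    by (simp add: qpoch_inf_def convergent_LIMSEQ_iff)
qed

lemma summable_phi11_term:
  assumes q: "0 < q" "q < 1"
  shows "summable (phi11_term q w z)"
proof -
  let ?Q = "of_real q :: complex"
  define g where "g = (\<lambda>k. (- (?Q ^ k) * z) / ((1 - w * ?Q ^ k) * (1 - ?Q * ?Q ^ k)))"
  have Q0: "(\<lambda>k. ?Q ^ k) \<longlonglongrightarrow> 0"
    using q by (intro LIMSEQ_power_zero) auto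
  have tri: "Suc k * (Suc k - 1) div 2 = k * (k - 1) div 2 + k" for k
  proof -
    have "Suc k * (Suc k - 1) = k * (k - 1) + k * 2"
      by (cases k) (auto simp: algebra_simps)
    then show ?thesis by simp
  qed
  have step: "phi11_term q w z (Suc k) = g k * phi11_term q w z k" for k
    unfolding phi11_term_def tri g_def
    by (simp add: qpoch_def power_add mult_ac)
  have "g \<longlonglongrightarrow> (- 0 * z) / ((1 - w * 0) * (1 - ?Q * 0))"
    unfolding g_def by (intro tendsto_intros Q0) auto
  then have "(\<lambda>k. norm (g k)) \<longlonglongrightarrow> 0"
    by (simp add: tendsto_norm_zero)
  then have "eventually (\<lambda>k. norm (g k) < 1/2) sequentially"
    by (rule order_tendstoD) simp
  then obtain N where N: "\<And>k. k \<ge> N \<Longrightarrow> norm (g k) < 1/2"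
    by (auto simp: eventually_sequentially)
  show ?thesis
  proof (rule summable_ratio_test[where c = "1/2" and N = N])
    fix k assume "k \<ge> N"
    then show "norm (phi11_term q w z (Suc k)) \<le> 1/2 * norm (phi11_term q w z k)"
      unfolding step norm_mult using N[of k] by (intro mult_right_mono) auto
  qed simp
qed

end

theory Submission
  imports Defs
begin

text \<open>
  With \<open>e\<^sub>n = q\<^bsup>n(n-1)/2\<^esup> / (q;q)\<^sub>n\<close>, Euler's identity reads
  \<open>(w;q)\<^sub>\<infinity> = \<Sum>\<^sub>n (-1)\<^sup>n e\<^sub>n w\<^sup>n\<close>. Inserting it for \<open>(q\<^sup>k w;q)\<^sub>\<infinity>\<close> in \<open>F\<close> gives the double power series
  \<open>F(w,z) = \<Sum>\<^sub>k\<^sub>,\<^sub>n (-1)\<^bsup>k+n\<^esup> e\<^sub>k e\<^sub>n q\<^bsup>kn\<^esup> z\<^sup>k w\<^sup>n\<close>, visibly symmetric. Since \<open>0 < q\<^bsup>kn\<^esup> \<le> 1\<close> it is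
  dominated by the product of the two Euler series of \<open>(-\<bar>z\<bar>;q)\<^sub>\<infinity>\<close> and \<open>(-\<bar>w\<bar>;q)\<^sub>\<infinity>\<close>.
\<close>

section \<open>Shifted factorials and Euler coefficients\<close>

definition euler_coeff :: "real \<Rightarrow> nat \<Rightarrow> real" where
  "euler_coeff q n = q ^ (n * (n - 1) div 2) / qpoch q q n"

lemma qpoch_self_pos:
  fixes q :: real
  assumes "0 < q" "q < 1"
  shows "qpoch q q n > 0"
  unfolding qpoch_def
proof (intro prod_pos ballI)
  fix j
  show "0 < 1 - q * of_real q ^ j"
    using power_Suc_less_one[of q j] assms by simp
qed

lemma qpoch_of_real: "qpoch (of_real a) q n = of_real (qpoch a q n)"
  by (simp add: qpoch_def)

lemma qpoch_add: "qpoch a q (k + n) = qpoch a q k * qpoch (of_real q ^ k * a) q n"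
  by (induction n) (simp_all add: qpoch_def power_add mult_ac)

text \<open>Limit \<open>n\<close> to infinity in \<open>qpoch_add\<close>. It trades the infinite
  product in \<open>F_term\<close> for the denominator \<open>qpoch w q k\<close> of
  \<open>phi11_term\<close>.\<close>

lemma qpoch_inf_shift:
  fixes a :: "'a::{real_normed_field,banach}"
  assumes "0 < q" "q < 1"
  shows "qpoch_inf a q = qpoch a q k * qpoch_inf (of_real q ^ k * a) q"
proof (rule LIMSEQ_unique)
  show "(\<lambda>n. qpoch a q (n + k)) \<longlonglongrightarrow> qpoch_inf a q"
    using qpoch_LIMSEQ[OF assms] by (rule LIMSEQ_ignore_initial_segment)
  show "(\<lambda>n. qpoch a q (n + k)) \<longlonglongrightarrow> qpoch a q k * qpoch_inf (of_real q ^ k * a) q"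
    unfolding add.commute[of _ k] qpoch_add
    by (intro tendsto_mult tendsto_const qpoch_LIMSEQ assms)
qed

lemma euler_coeff_nonneg:
  assumes "0 < q" "q < 1"
  shows "euler_coeff q n \<ge> 0"
  using qpoch_self_pos[OF assms, of n] assms by (simp add: euler_coeff_def)

lemma triangular_Suc: "Suc k * (Suc k - 1) div 2 = k * (k - 1) div 2 + k"
proof -
  have "Suc k * (Suc k - 1) = k * (k - 1) + k * 2"
    by (cases k) (auto simp: algebra_simps)
  then show ?thesis by simp
qed

lemma euler_coeff_Suc:
  "euler_coeff q (Suc n) = q ^ n / (1 - q ^ Suc n) * euler_coeff q n"
  unfolding euler_coeff_def triangular_Suc
  by (simp add: qpoch_def power_add mult_ac)

text \<open>This is the functional equation \<open>G(w) = (1 - w) G(q w)\<close> of the Euler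
  series, read coefficient by coefficient.\<close>

lemma euler_coeff_recurrence:
  assumes "0 < q" "q < 1"
  shows "euler_coeff q (Suc n) * (1 - q ^ Suc n) = q ^ n * euler_coeff q n"
proof -
  have "1 - q ^ Suc n \<noteq> 0"
    using power_Suc_less_one[of q n] assms by simp
  then show ?thesis
    unfolding euler_coeff_Suc by simp
qed

text \<open>The ratio \<open>q^k x / (1 - q^(k+1))\<close> of successive terms tends to 0, so the
  ratio test applies for every \<open>x\<close>.\<close>

lemma summable_euler:
  assumes q: "0 < q" "q < 1"
  shows "summable (\<lambda>n. euler_coeff q n * x ^ n)"
proof -
  define g where "g = (\<lambda>k. q ^ k / (1 - q * q ^ k) * x)"
  have Q0: "(\<lambda>k. q ^ k) \<longlonglongrightarrow> 0"
    using q by (intro LIMSEQ_power_zero) auto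
  have step: "euler_coeff q (Suc k) * x ^ Suc k = g k * (euler_coeff q k * x ^ k)" for k
    unfolding euler_coeff_Suc g_def by simp
  have "g \<longlonglongrightarrow> 0 / (1 - q * 0) * x"
    unfolding g_def by (intro tendsto_intros Q0) auto
  then have "(\<lambda>k. norm (g k)) \<longlonglongrightarrow> 0"
    by (simp add: tendsto_rabs_zero)
  then have "eventually (\<lambda>k. norm (g k) < 1/2) sequentially"
    by (rule order_tendstoD) simp
  then obtain N where N: "\<And>k. k \<ge> N \<Longrightarrow> norm (g k) < 1/2"
    by (auto simp: eventually_sequentially)
  show ?thesis
  proof (rule summable_ratio_test[where c = "1/2" and N = N])
    fix k assume "k \<ge> N"
    then show "norm (euler_coeff q (Suc k) * x ^ Suc k) \<le> 1/2 * norm (euler_coeff q k * x ^ k)"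
      unfolding step norm_mult[of "g k"] using N[of k] by (intro mult_right_mono) auto
  qed simp
qed

section \<open>Euler's identity\<close>

definition euler_term :: "real \<Rightarrow> 'a::real_normed_field \<Rightarrow> nat \<Rightarrow> 'a" where
  "euler_term q w n = of_real ((-1) ^ n * euler_coeff q n) * w ^ n"

lemma norm_euler_term:
  assumes "0 < q" "q < 1"
  shows "norm (euler_term q w n) = euler_coeff q n * norm w ^ n"
  using euler_coeff_nonneg[OF assms, of n]
  by (simp add: euler_term_def norm_mult norm_power)

lemma summable_norm_euler_term:
  assumes "0 < q" "q < 1"
  shows "summable (\<lambda>n. norm (euler_term q w n))"
  unfolding norm_euler_term[OF assms] by (rule summable_euler[OF assms])

lemma summable_euler_term:
  fixes w :: "'a::{real_normed_field,banach}"
  assumes "0 < q" "q < 1"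
  shows "summable (euler_term q w)"
  using summable_norm_euler_term[OF assms] by (rule summable_norm_cancel)

text \<open>The infinite product obeys the same functional equation, so iterating it identifies the
  series with the product.\<close>

lemma suminf_euler_term_shift:
  fixes w :: "'a::{real_normed_field,banach}"
  assumes q: "0 < q" "q < 1"
  shows "suminf (euler_term q w) = (1 - w) * suminf (euler_term q (of_real q * w))"
proof -
  let ?v = "of_real q * w"
  have zero: "euler_term q u 0 = 1" for u :: 'a
    by (simp add: euler_term_def euler_coeff_def qpoch_def)
  have Suc: "euler_term q w (Suc n) = euler_term q ?v (Suc n) - w * euler_term q ?v n" for n
  proof -
    have "of_real (euler_coeff q (Suc n)) =
        of_real (euler_coeff q (Suc n) * q ^ Suc n + q ^ n * euler_coeff q n :: real)"
      using euler_coeff_recurrence[OF q, of n] by (simp add: algebra_simps)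
    then have "(of_real (euler_coeff q (Suc n)) :: 'a) =
        of_real (euler_coeff q (Suc n)) * of_real q ^ Suc n + of_real q ^ n * of_real (euler_coeff q n)"
      by simp
    \<comment> \<open>With the sign absorbed into \<open>- w\<close>, the second summand becomes
      \<open>- w\<close> times the \<open>n\<close>-th term at \<open>q w\<close>.\<close>
    then have "of_real (euler_coeff q (Suc n)) * ((- w) ^ Suc n) =
        (of_real (euler_coeff q (Suc n)) * of_real q ^ Suc n + of_real q ^ n * of_real (euler_coeff q n))
          * ((- w) ^ Suc n)"
      by (rule arg_cong)
    then show ?thesis
      by (simp add: euler_term_def power_minus[of w] power_mult_distrib algebra_simps)
  qed
  note S = summable_euler_term[OF q]
  have "suminf (euler_term q w) = 1 + (\<Sum>n. euler_term q w (Suc n))"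
    using suminf_split_head[OF S, of w] by (simp add: zero)
  also have "(\<Sum>n. euler_term q w (Suc n)) =
      (\<Sum>n. euler_term q ?v (Suc n)) - (\<Sum>n. w * euler_term q ?v n)"
    unfolding Suc
    by (intro suminf_diff[symmetric] summable_mult S) (simp add: summable_Suc_iff S)
  also have "\<dots> = suminf (euler_term q ?v) - 1 - w * suminf (euler_term q ?v)"
    using suminf_split_head[OF S, of ?v] suminf_mult[OF S, of w ?v] by (simp add: zero)
  finally show ?thesis
    by (simp add: algebra_simps)
qed

text \<open>Iterating the functional equation \<open>k\<close> times moves the argument to
  \<open>q^k w\<close>, which tends to 0. The series is continuous at 0 with value 1 there, so only
  the product survives in the limit.\<close>

theorem euler_sums:
  fixes w :: "'a::{real_normed_field,banach}"
  assumes q: "0 < q" "q < 1"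
  shows "euler_term q w sums qpoch_inf w q"
proof -
  let ?G = "\<lambda>w::'a. suminf (euler_term q w)"
  have iterate: "?G w = qpoch w q k * ?G (of_real q ^ k * w)" for k
  proof (induction k)
    case (Suc k)
    then show ?case
      using suminf_euler_term_shift[OF q, of "of_real q ^ k * w"]
      by (simp add: qpoch_def mult_ac)
  qed (simp add: qpoch_def)
  have "isCont ?G 0"
    using isCont_powser_converges_everywhere
      [of "\<lambda>n. of_real ((-1) ^ n * euler_coeff q n) :: 'a" 0] summable_euler_term[OF q]
    unfolding euler_term_def by blast
  moreover have "(\<lambda>k. of_real q ^ k * w) \<longlonglongrightarrow> 0"
    using q by (intro tendsto_mult_left_zero LIMSEQ_power_zero) simp
  ultimately have "(\<lambda>k. ?G (of_real q ^ k * w)) \<longlonglongrightarrow> ?G 0"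
    by (rule isCont_tendsto_compose)
  moreover have "?G 0 = 1"
    unfolding euler_term_def[abs_def] powser_zero by (simp add: euler_coeff_def qpoch_def)
  ultimately have "(\<lambda>k. qpoch w q k * ?G (of_real q ^ k * w)) \<longlonglongrightarrow> qpoch_inf w q * 1"
    by (intro tendsto_mult qpoch_LIMSEQ q) simp
  then have "?G w = qpoch_inf w q"
    unfolding iterate[symmetric] by (simp add: LIMSEQ_const_iff)
  then show ?thesis
    using summable_sums[OF summable_euler_term[OF q, of w]] by simp
qed

section \<open>Unordered Euler sums and their products\<close>

lemma euler_has_sum:
  fixes w :: "'a::{real_normed_field,banach}"
  assumes "0 < q" "q < 1"
  shows "(euler_term q w has_sum qpoch_inf w q) UNIV"
  by (rule norm_summable_imp_has_sum[OF summable_norm_euler_term euler_sums]) (use assms in auto)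

text \<open>At the negative argument \<open>- norm w\<close> the alternating signs cancel, so the
  majorant is itself a real instance of Euler's identity.\<close>

lemma euler_has_sum_norm:
  fixes w :: complex
  assumes "0 < q" "q < 1"
  shows "((\<lambda>n. euler_coeff q n * norm w ^ n) has_sum qpoch_inf (- norm w) q) UNIV"
proof -
  have "(-1) ^ n * (- norm w) ^ n = norm w ^ n" for n
    by (simp flip: power_mult_distrib)
  then have "euler_term q (- norm w) = (\<lambda>n. euler_coeff q n * norm w ^ n)"
    by (simp add: euler_term_def fun_eq_iff mult_ac)
  then show ?thesis
    using euler_has_sum[OF assms, of "- norm w"] by simp
qed

text \<open>By nonnegativity the row sums are also sums of absolute values, so Tonelli gives
  summability over all pairs.\<close>

lemma has_sum_mult_product:
  fixes f :: "'a \<Rightarrow> real" and g :: "'b \<Rightarrow> real"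
  assumes f: "(f has_sum s) UNIV" and g: "(g has_sum t) UNIV"
    and nonneg: "\<And>x. f x \<ge> 0" "\<And>y. g y \<ge> 0"
  shows "((\<lambda>(x, y). f x * g y) has_sum s * t) UNIV"
proof -
  have rows: "((\<lambda>y. f x * g y) has_sum f x * t) UNIV" for x
    by (rule has_sum_cmult_right[OF g])
  have total: "((\<lambda>x. f x * t) has_sum s * t) UNIV"
    by (rule has_sum_cmult_left[OF f])
  have rows_inf: "(\<Sum>\<^sub>\<infinity>y. f x * g y) = f x * t" for x
    by (rule infsumI[OF rows])
  have "(\<lambda>p. norm (case p of (x, y) \<Rightarrow> f x * g y)) summable_on Sigma UNIV (\<lambda>_. UNIV)"
    unfolding Infinite_Sum.abs_summable_on_Sigma_iff
    using rows total has_sum_nonneg[OF g] nonneg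
    by (auto simp: rows_inf abs_mult intro: has_sum_imp_summable)
  then have "(\<lambda>(x, y). f x * g y) summable_on Sigma UNIV (\<lambda>_. UNIV)"
    by (rule Infinite_Sum.abs_summable_summable)
  then have "((\<lambda>(x, y). f x * g y) has_sum s * t) (Sigma UNIV (\<lambda>_. UNIV))"
    by (intro has_sum_SigmaI[where g = "\<lambda>x. f x * t"]) (use rows total in auto)
  then show ?thesis by simp
qed

section \<open>The double power series of \<open>F\<close>\<close>

definition F_coeff :: "real \<Rightarrow> nat \<Rightarrow> nat \<Rightarrow> real" where
  "F_coeff q k n = (-1) ^ (k + n) * euler_coeff q k * euler_coeff q n * q ^ (k * n)"

text \<open>The coupling factor \<open>q ^ (k * n)\<close> is at most 1; dropping it makes the
  majorant factorise.\<close>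

lemma norm_F_coeff_le:
  assumes "0 < q" "q < 1"
  shows "norm (of_real (F_coeff q k n) * z ^ k * w ^ n :: complex)
    \<le> (euler_coeff q k * norm z ^ k) * (euler_coeff q n * norm w ^ n)"
proof -
  have "norm (of_real (F_coeff q k n) * z ^ k * w ^ n :: complex) =
      (euler_coeff q k * norm z ^ k) * (euler_coeff q n * norm w ^ n) * q ^ (k * n)"
    using assms euler_coeff_nonneg[OF assms]
    by (simp add: F_coeff_def norm_mult norm_power abs_mult)
  also have "\<dots> \<le> (euler_coeff q k * norm z ^ k) * (euler_coeff q n * norm w ^ n) * 1"
    using assms euler_coeff_nonneg[OF assms]
    by (intro mult_left_mono power_le_one mult_nonneg_nonneg) auto
  finally show ?thesis by simp
qed

lemma euler_product_has_sum:
  fixes z w :: complex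
  assumes "0 < q" "q < 1"
  shows "((\<lambda>(k, n). (euler_coeff q k * norm z ^ k) * (euler_coeff q n * norm w ^ n))
    has_sum qpoch_inf (- norm z) q * qpoch_inf (- norm w) q) UNIV"
  by (intro has_sum_mult_product euler_has_sum_norm assms mult_nonneg_nonneg
        euler_coeff_nonneg zero_le_power norm_ge_zero)

lemma F_coeff_abs_summable:
  fixes z w :: complex
  assumes "0 < q" "q < 1"
  shows "(\<lambda>p. norm (case p of (k, n) \<Rightarrow> of_real (F_coeff q k n) * z ^ k * w ^ n)) summable_on UNIV"
  using has_sum_imp_summable[OF euler_product_has_sum[OF assms, of z w]]
  by (rule Infinite_Sum.abs_summable_on_comparison_test') (use norm_F_coeff_le[OF assms] in auto)

lemma F_term_eq:
  assumes "0 < q" "q < 1"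
  shows "F_term q w z k = euler_term q z k * qpoch_inf (of_real q ^ k * w) q"
  by (simp add: F_term_def euler_term_def euler_coeff_def qpoch_of_real)

lemma F_row_has_sum:
  assumes "0 < q" "q < 1"
  shows "((\<lambda>n. of_real (F_coeff q k n) * z ^ k * w ^ n) has_sum F_term q w z k) UNIV"
proof -
  have "((\<lambda>n. euler_term q z k * euler_term q (of_real q ^ k * w) n) has_sum F_term q w z k) UNIV"
    unfolding F_term_eq[OF assms] by (intro has_sum_cmult_right euler_has_sum assms)
  \<comment> \<open>The factor \<open>q ^ (k * n)\<close> of \<open>F_coeff\<close> arises from
    \<open>(q ^ k * w) ^ n\<close>.\<close>
  moreover have "euler_term q z k * euler_term q (of_real q ^ k * w) n
      = of_real (F_coeff q k n) * z ^ k * w ^ n" for n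
    by (simp add: euler_term_def F_coeff_def power_mult_distrib power_add power_mult mult_ac)
  ultimately show ?thesis by simp
qed

text \<open>Fubini, summing over \<open>n\<close> first. The shared value \<open>s\<close> yields
  both summability of \<open>F_term\<close> and the value of the double sum, before
  \<open>suminf\<close> is known to be meaningful.\<close>

lemma F_term_has_sum:
  assumes "0 < q" "q < 1"
  shows "\<exists>s. (F_term q w z has_sum s) UNIV \<and>
    ((\<lambda>(k, n). of_real (F_coeff q k n) * z ^ k * w ^ n) has_sum s) UNIV"
proof -
  obtain s where s: "((\<lambda>(k, n). of_real (F_coeff q k n) * z ^ k * w ^ n) has_sum s) UNIV"
    using Infinite_Sum.abs_summable_summable[OF F_coeff_abs_summable[OF assms]] by (auto simp: summable_on_def)
  have "(F_term q w z has_sum s) UNIV"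
    by (rule has_sum_SigmaD[where B = "\<lambda>_. UNIV"]) (use s F_row_has_sum[OF assms] in auto)
  with s show ?thesis by blast
qed

lemma summable_F_term:
  assumes "0 < q" "q < 1"
  shows "summable (F_term q w z)"
  using F_term_has_sum[OF assms, of w z] by (meson has_sum_imp_sums sums_summable)

theorem F_has_sum:
  assumes "0 < q" "q < 1"
  shows "((\<lambda>(k, n). of_real (F_coeff q k n) * z ^ k * w ^ n) has_sum F q w z) UNIV"
  using F_term_has_sum[OF assms, of w z] by (auto simp: F_def dest: has_sum_imp_sums sums_unique)

section \<open>Symmetry and the bound\<close>

lemma F_symmetric:
  assumes "0 < q" "q < 1"
  shows "F q w z = F q z w"
proof (rule has_sum_unique)
  show "((\<lambda>(k, n). of_real (F_coeff q k n) * z ^ k * w ^ n) has_sum F q w z) UNIV"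
    by (rule F_has_sum[OF assms])
  have "((\<lambda>(n, k). of_real (F_coeff q k n) * w ^ k * z ^ n) has_sum F q z w) UNIV"
    using F_has_sum[OF assms, of w z]
      has_sum_swap[of "\<lambda>(k, n). of_real (F_coeff q k n) * w ^ k * z ^ n" UNIV UNIV "F q z w"]
    by simp
  \<comment> \<open>After renaming the indices this rests on
    \<open>F_coeff q n k = F_coeff q k n\<close>.\<close>
  then show "((\<lambda>(k, n). of_real (F_coeff q k n) * z ^ k * w ^ n) has_sum F q z w) UNIV"
    by (simp add: F_coeff_def mult_ac add.commute)
qed

lemma norm_F_le:
  assumes "0 < q" "q < 1"
  shows "norm (F q w z) \<le> qpoch_inf (- norm z) q * qpoch_inf (- norm w) q"
proof -
  let ?f = "\<lambda>(k, n). of_real (F_coeff q k n) * z ^ k * w ^ n"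
  have sum: "((\<lambda>p. norm (?f p)) has_sum (\<Sum>\<^sub>\<infinity>p. norm (?f p))) UNIV"
    using F_coeff_abs_summable[OF assms] by (rule has_sum_infsum)
  have "norm (F q w z) \<le> (\<Sum>\<^sub>\<infinity>p. norm (?f p))"
    by (rule norm_has_sum_bound[OF sum F_has_sum[OF assms]])
  also have "\<dots> \<le> qpoch_inf (- norm z) q * qpoch_inf (- norm w) q"
    by (rule has_sum_mono[OF sum euler_product_has_sum[OF assms]])
       (use norm_F_coeff_le[OF assms] in auto)
  finally show ?thesis .
qed

section \<open>Agreement with the basic hypergeometric series\<close>

lemma F_eq_phi11:
  assumes q: "0 < q" "q < 1" and w: "w \<notin> {1 / of_real q ^ n | n :: nat. True}"
  shows "F q w z = qpoch_inf w q * phi11 q w z"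
proof -
  \<comment> \<open>A zero of a finite product would be an excluded point, so
    \<open>qpoch w q k\<close> may be cancelled.\<close>
  have "qpoch w q k \<noteq> 0" for k
  proof
    assume "qpoch w q k = 0"
    then obtain j where "w * of_real q ^ j = 1"
      by (auto simp: qpoch_def)
    then have "w = 1 / of_real q ^ j"
      using q by (simp add: field_simps)
    with w show False by blast
  qed
  then have "F_term q w z k = qpoch_inf w q * phi11_term q w z k" for k
    unfolding F_term_def phi11_term_def qpoch_inf_shift[OF q, of w k] by simp
  then have "F_term q w z = (\<lambda>k. qpoch_inf w q * phi11_term q w z k)" ..
  then show ?thesis
    unfolding F_def phi11_def by (simp add: suminf_mult summable_phi11_term[OF q])
qed

section \<open>Re-centring a double power series\<close>

lemma binomial_has_sum:
  fixes x y :: "'a::{real_normed_field,banach}"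
  shows "((\<lambda>i. of_nat (k choose i) * x ^ i * y ^ (k - i)) has_sum (x + y) ^ k) UNIV"
  unfolding binomial_ring
  \<comment> \<open>For \<open>i > k\<close> the binomial coefficient vanishes, so the truncated
    \<open>k - i\<close> does no harm.\<close>
  by (rule has_sum_finite_neutralI) (auto simp: binomial_eq_0)

text \<open>Used with the norms of shift and centre, to evaluate the absolute row sums of the
  expansion.\<close>

lemma double_binomial_has_sum:
  fixes s t u v :: real
  assumes "s \<ge> 0" "t \<ge> 0" "u \<ge> 0" "v \<ge> 0"
  shows "((\<lambda>(i, j). (of_nat (k choose i) * s ^ i * u ^ (k - i)) * (of_nat (n choose j) * t ^ j * v ^ (n - j)))
    has_sum (s + u) ^ k * (t + v) ^ n) UNIV"
  by (intro has_sum_mult_product binomial_has_sum) (use assms in auto)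

text \<open>Expanding \<open>(u + s)\<^sup>k (v + t)\<^sup>n\<close> binomially and interchanging the sums re-centres the series at \<open>(u, v)\<close>.\<close>

theorem entire2_double_power_series:
  fixes a :: "nat \<Rightarrow> nat \<Rightarrow> complex"
  assumes summable: "\<And>x y. (\<lambda>p. norm (case p of (k, n) \<Rightarrow> a k n * x ^ k * y ^ n)) summable_on UNIV"
    and sum: "\<And>x y. ((\<lambda>(k, n). a k n * x ^ k * y ^ n) has_sum f (x, y)) UNIV"
  shows "entire2 f"
  unfolding entire2_def
proof
  fix p :: "complex \<times> complex"
  obtain u v where p: "p = (u, v)" by (cases p)
  \<comment> \<open>\<open>b k n i j\<close> is what the monomial with coefficient
    \<open>a k n\<close> contributes to the coefficient of
    \<open>(x - u) ^ i * (y - v) ^ j\<close>.\<close>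
  define b where "b k n i j = a k n * ((of_nat (k choose i) * u ^ (k - i)) * (of_nat (n choose j) * v ^ (n - j)))"
    for k n i j
  define c where "c i j = (\<Sum>\<^sub>\<infinity>(k, n). b k n i j)" for i j
  have "((\<lambda>(i, j). c i j * (x - u) ^ i * (y - v) ^ j) has_sum f (x, y)) UNIV" for x y
  proof -
    define s t where "s = x - u" and "t = y - v"
    define h where "h = (\<lambda>((k, n), (i, j)). b k n i j * s ^ i * t ^ j)"
    define B where "B k i = of_nat (k choose i) * s ^ i * u ^ (k - i)" for k i
    define C where "C n j = of_nat (n choose j) * t ^ j * v ^ (n - j)" for n j
    have h: "h ((k, n), (i, j)) = a k n * (B k i * C n j)" for k n i j
      by (simp add: h_def b_def B_def C_def mult_ac)
    have norm_row: "((\<lambda>(i, j). norm (B k i * C n j))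
        has_sum (norm s + norm u) ^ k * (norm t + norm v) ^ n) UNIV" for k n
      using double_binomial_has_sum[of "norm s" "norm t" "norm u" "norm v" k n]
      by (simp add: B_def C_def norm_mult norm_power)
    \<comment> \<open>Each absolute row sum is the norm of the original term at
      \<open>(norm s + norm u, norm t + norm v)\<close>; assumption \<open>summable\<close> at that
      point then makes the four-fold family absolutely summable.\<close>
    have norm_h: "((\<lambda>ij. norm (h (kn, ij))) has_sum
        norm (case kn of (k, n) \<Rightarrow>
          a k n * of_real (norm s + norm u) ^ k * of_real (norm t + norm v) ^ n)) UNIV" for kn
    proof (cases kn)
      case (Pair k n)
      have "norm (h (kn, ij)) = norm (a k n) * (case ij of (i, j) \<Rightarrow> norm (B k i * C n j))" for ij
        by (cases ij) (simp add: Pair h norm_mult)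
      then show ?thesis
        using has_sum_cmult_right[OF norm_row[of k n], of "norm (a k n)"]
        by (simp add: Pair norm_mult norm_power mult.assoc flip: of_real_add)
    qed
    have row: "((\<lambda>ij. h (kn, ij)) has_sum (case kn of (k, n) \<Rightarrow> a k n * x ^ k * y ^ n)) UNIV" for kn
    proof (cases kn)
      case (Pair k n)
      have B: "(B k has_sum x ^ k) UNIV" and C: "(C n has_sum y ^ n) UNIV"
        using binomial_has_sum[of k s u] binomial_has_sum[of n t v]
        by (simp_all add: B_def[abs_def] C_def[abs_def] s_def t_def)
      have abs: "(\<lambda>(i, j). B k i * C n j) summable_on Sigma UNIV (\<lambda>_. UNIV)"
      proof (rule Infinite_Sum.abs_summable_summable)
        show "(\<lambda>p. norm (case p of (i, j) \<Rightarrow> B k i * C n j)) summable_on Sigma UNIV (\<lambda>_. UNIV)"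
          using has_sum_imp_summable[OF norm_row[of k n]] by (simp add: case_prod_unfold)
      qed
      have "((\<lambda>(i, j). B k i * C n j) has_sum x ^ k * y ^ n) (Sigma UNIV (\<lambda>_. UNIV))"
        by (rule has_sum_SigmaI[where g = "\<lambda>i. B k i * y ^ n", OF _ _ abs])
           (auto intro: has_sum_cmult_right[OF C] has_sum_cmult_left[OF B])
      then have "((\<lambda>ij. a k n * (case ij of (i, j) \<Rightarrow> B k i * C n j)) has_sum a k n * (x ^ k * y ^ n)) UNIV"
        by (intro has_sum_cmult_right) simp
      moreover have "(\<lambda>ij. a k n * (case ij of (i, j) \<Rightarrow> B k i * C n j)) = (\<lambda>ij. h (kn, ij))"
        by (auto simp: h Pair)
      ultimately show ?thesis
        by (simp add: Pair mult.assoc)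
    qed
    have "(\<lambda>p. norm (h p)) summable_on Sigma UNIV (\<lambda>_. UNIV)"
      unfolding Infinite_Sum.abs_summable_on_Sigma_iff
    proof (intro conjI ballI)
      show "(\<lambda>ij. norm (h (kn, ij))) summable_on UNIV" for kn
        using norm_h by (rule has_sum_imp_summable)
      show "(\<lambda>kn. norm (\<Sum>\<^sub>\<infinity>ij. norm (h (kn, ij)))) summable_on UNIV"
        unfolding infsumI[OF norm_h] real_norm_def abs_norm_cancel by (rule summable)
    qed
    then have hs: "h summable_on UNIV \<times> UNIV"
      by (rule Infinite_Sum.abs_summable_summable)
    then have "(h has_sum f (x, y)) (UNIV \<times> UNIV)"
      by (intro has_sum_SigmaI[OF row sum])
    then have swapped: "((\<lambda>(ij, kn). h (kn, ij)) has_sum f (x, y)) (UNIV \<times> UNIV)"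
      by (rule iffD1[OF has_sum_swap])
    have col: "((\<lambda>kn. (\<lambda>(ij, kn). h (kn, ij)) (ij, kn)) has_sum
        (case ij of (i, j) \<Rightarrow> c i j * s ^ i * t ^ j)) UNIV" for ij
    proof (cases ij)
      case (Pair i j)
      have "(\<lambda>kn. h (kn, ij)) summable_on UNIV"
        by (rule summable_on_SigmaD1[where A = UNIV and B = "\<lambda>_. UNIV" and f = "\<lambda>ij kn. h (kn, ij)"])
           (use has_sum_imp_summable[OF swapped] in auto)
      moreover have "(\<Sum>\<^sub>\<infinity>kn. h (kn, ij)) = (\<Sum>\<^sub>\<infinity>kn. s ^ i * t ^ j * (case kn of (k, n) \<Rightarrow> b k n i j))"
        by (rule infsum_cong) (auto simp: h_def Pair)
      \<comment> \<open>If \<open>s ^ i * t ^ j = 0\<close>, summability of \<open>h\<close> here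
        does not control the series for \<open>c i j\<close>, but both sides are 0;
        \<open>infsum_cmult_right'\<close> covers this case too.\<close>
      then have "(\<Sum>\<^sub>\<infinity>kn. h (kn, ij)) = c i j * s ^ i * t ^ j"
        by (simp add: infsum_cmult_right' c_def)
      ultimately show ?thesis
        using has_sum_infsum[of "\<lambda>kn. h (kn, ij)" UNIV] by (simp add: Pair)
    qed
    show ?thesis
      using has_sum_SigmaD[OF swapped col] by (simp add: s_def t_def)
  qed
  then show "analytic2_at f p"
    \<comment> \<open>The expansion holds for all \<open>x\<close> and \<open>y\<close>, so the
      radius 1 is arbitrary.\<close>
    unfolding analytic2_at_def p fst_conv snd_conv by (intro exI[of _ 1] exI[of _ c]) auto
qed

theorem proposition2p1:
  fixes q :: real
  assumes "0 < q" and "q < 1"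
  shows "(\<forall>w z. summable (F_term q w z))
    \<and> (\<forall>w z. w \<notin> {1 / of_real q ^ n | n :: nat. True} \<longrightarrow> F q w z = qpoch_inf w q * phi11 q w z)
    \<and> entire2 (\<lambda>(z, w). F q w z)
    \<and> (\<forall>z w. F q w z = F q z w)
    \<and> (\<forall>z w. norm (F q w z) \<le> qpoch_inf (- norm z) q * qpoch_inf (- norm w) q)"
proof (intro conjI allI impI)
  show "entire2 (\<lambda>(z, w). F q w z)"
    by (rule entire2_double_power_series[where a = "\<lambda>k n. of_real (F_coeff q k n)"])
       (use F_coeff_abs_summable F_has_sum assms in auto)
qed ((rule summable_F_term F_eq_phi11 norm_F_le F_symmetric; (rule assms | assumption))+)

end
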